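(* Let $[x^{\mathsf T},y^{\mathsf T}]^{\mathsf T}$ be the unique solution of the generalized saddle point problem $$\mathcal M\begin{bmatrix}x\\ y\end{bmatrix}=\begin{bmatrix}A&B^{\mathsf T}\\ B&D\end{bmatrix}\begin{bmatrix}x\\ y\end{bmatrix}=\begin{bmatrix}f\\ g\end{bmatrix}=\mathbf d ,$$ and let $\mathbf L\in\mathbb R^{k\times(m+n)}$. Assume $\mathbf L[x^{\mathsf T},y^{\mathsf T}]^{\mathsf T}\neq\mathbf 0$ (and, for the formula for $\mathscr C$, that all entries of $\mathbf L[x^{\mathsf T},y^{\mathsf T}]^{\mathsf T}$ are nonzero). Then the unstructured normwise, mixed and componentwise condition numbers of $\mathbf L[x^{\mathsf T},y^{\mathsf T}]^{\mathsf T}$ are $$\mathscr K(\mathbf L[x^{\mathsf T},y^{\mathsf T}]^{\mathsf T})=\frac{\left\|\mathbf L\mathcal M^{-1}\begin{bmatrix}\mathcal R&-I_{m+n}\end{bmatrix}\right\|_2\left\|\begin{bmatrix}\mathbf H&\mathbf d\end{bmatrix}\right\|_F}{\left\|\mathbf L[x^{\mathsf T},y^{\mathsf T}]^{\mathsf T}\right\|_2},$$ $$\mathscr M(\mathbf L[x^{\mathsf T},y^{\mathsf T}]^{\mathsf T})=\frac{\left\||\mathbf L\mathcal M^{-1}\mathcal R|\begin{bmatrix}\mathrm{vec}(|A|)\\ \mathrm{vec}(|B|)\\ \mathrm{vec}(|D|)\end{bmatrix}+|\mathbf L\mathcal M^{-1}|\begin{bmatrix}|f|\\ |g|\end{bmatrix}\right\|_\infty}{\left\|\mathbf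 L[x^{\mathsf T},y^{\mathsf T}]^{\mathsf T}\right\|_\infty},$$ $$\mathscr C(\mathbf L[x^{\mathsf T},y^{\mathsf T}]^{\mathsf T})=\left\|\mathbf D^{\dagger}_{\mathbf L[x^{\mathsf T},y^{\mathsf T}]^{\mathsf T}}|\mathbf L\mathcal M^{-1}\mathcal R|\begin{bmatrix}\mathrm{vec}(|A|)\\ \mathrm{vec}(|B|)\\ \mathrm{vec}(|D|)\end{bmatrix}+\mathbf D^{\dagger}_{\mathbf L[x^{\mathsf T},y^{\mathsf T}]^{\mathsf T}}|\mathbf L\mathcal M^{-1}|\begin{bmatrix}|f|\\ |g|\end{bmatrix}\right\|_\infty .$$
   Context: Notation: $\|\cdot\|_2$ is the Euclidean norm of a vector / spectral norm of a matrix, $\|\cdot\|_\infty$ the infinity norm, $\|\cdot\|_F$ the Frobenius norm. $|X|$ is the entrywise absolute value, and $X\le Y$ for matrices is entrywise. $\mathrm{vec}$ stacks columns, $\otimes$ is the Kronecker product. For a vector $v$, $\mathbf D_v$ is the diagonal matrix with diagonal $v$; $\dagger$ is the Moore-Penrose inverse. Quotients of vectors are entrywise, with $0/0=0$ and $a/0=\infty$ for $a\ne0$. Setting: $A\in\mathbb R^{m\times m}$, $B\in\mathbb R^{n\times m}$, $D\in\mathbb R^{n\times n}$, $x,f\in\mathbb R^m$, $y,g\in\mathbb R^n$; $A$ and $\mathcal M$ are nonsingular. Put $\mathbf H=\begin{bmatrix}A&\mathbf 0\\ B&D\end{bmatrix}$, $\mathbf d=\begin{bmatrix}f\\ g\end{bmatrix}$,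 and $$\mathcal R=\begin{bmatrix}x^{\mathsf T}\otimes I_m&I_m\otimes y^{\mathsf T}&\mathbf 0\\ \mathbf 0&x^{\mathsf T}\otimes I_n&y^{\mathsf T}\otimes I_n\end{bmatrix}.$$ For perturbations $\Delta A,\Delta B,\Delta D,\Delta f,\Delta g$ put $\Delta\mathbf H=\begin{bmatrix}\Delta A&\mathbf 0\\ \Delta B&\Delta D\end{bmatrix}$, $\Delta\mathbf d=\begin{bmatrix}\Delta f\\ \Delta g\end{bmatrix}$, and let $[(x+\Delta x)^{\mathsf T},(y+\Delta y)^{\mathsf T}]^{\mathsf T}$ be the unique solution (for small perturbations) of $$\begin{bmatrix}A+\Delta A&(B+\Delta B)^{\mathsf T}\\ B+\Delta B&D+\Delta D\end{bmatrix}\begin{bmatrix}x+\Delta x\\ y+\Delta y\end{bmatrix}=\begin{bmatrix}f+\Delta f\\ g+\Delta g\end{bmatrix}.$$ Definitions of the condition numbers: $$\mathscr K(\mathbf L[x^{\mathsf T},y^{\mathsf T}]^{\mathsf T})=\lim_{\eta\to0}\sup\left\{\frac{\|\mathbf L[\Delta x^{\mathsf T},\Delta y^{\mathsf T}]^{\mathsf T}\|_2}{\eta\|\mathbf L[x^{\mathsf T},y^{\mathsf T}]^{\mathsf T}\|_2}:\|[\Delta\mathbf H\ \ \Delta\mathbf d]\|_F\le\eta\|[\mathbf H\ \ \mathbf d]\|_F\right\},$$ $$\mathscr M(\mathbf L[x^{\mathsf T},y^{\mathsf T}]^{\mathsf T})=\lim_{\eta\to0}\sup\left\{\frac{\|\mathbf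 L[\Delta x^{\mathsf T},\Delta y^{\mathsf T}]^{\mathsf T}\|_\infty}{\eta\|\mathbf L[x^{\mathsf T},y^{\mathsf T}]^{\mathsf T}\|_\infty}:|[\Delta\mathbf H\ \ \Delta\mathbf d]|\le\eta|[\mathbf H\ \ \mathbf d]|\right\},$$ $$\mathscr C(\mathbf L[x^{\mathsf T},y^{\mathsf T}]^{\mathsf T})=\lim_{\eta\to0}\sup\left\{\frac1\eta\left\|\frac{\mathbf L[\Delta x^{\mathsf T},\Delta y^{\mathsf T}]^{\mathsf T}}{\mathbf L[x^{\mathsf T},y^{\mathsf T}]^{\mathsf T}}\right\|_\infty:|[\Delta\mathbf H\ \ \Delta\mathbf d]|\le\eta|[\mathbf H\ \ \mathbf d]|\right\}.$$ *)

theory Defs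
  imports "HOL-Analysis.Analysis"
begin

text \<open>
  The order and the absolute value on \<open>real^'n\<close> and \<open>real^'n^'m\<close> are entrywise,
  and \<^const>\<open>norm\<close> on \<open>real^'n^'m\<close> is the Frobenius norm. The spectral norm of
  \<open>X\<close> is \<open>onorm ((*v) X)\<close>.
\<close>

text \<open>A matrix is a vector of rows, so \<open>vstack\<close> stacks vectors as well as matrices.\<close>

definition vstack :: "'a^'p \<Rightarrow> 'a^'q \<Rightarrow> 'a^('p + 'q)" where
  "vstack u v = (\<chi> i. case i of Inl p \<Rightarrow> u $ p | Inr q \<Rightarrow> v $ q)"

definition hstack :: "'a^'p^'r \<Rightarrow> 'a^'q^'r \<Rightarrow> 'a^('p + 'q)^'r" where
  "hstack X Y = (\<chi> i. vstack (X $ i) (Y $ i))"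

text \<open>Columns are stacked, so the column index is the first (major) component of the index.\<close>

definition vec_of :: "'a^'c^'r \<Rightarrow> 'a^('c \<times> 'r)" where
  "vec_of X = (\<chi> ji. X $ snd ji $ fst ji)"

definition kron :: "real^'c^'r \<Rightarrow> real^'d^'s \<Rightarrow> real^('c \<times> 'd)^('r \<times> 's)" where
  "kron X Y = (\<chi> ik jl. X $ fst ik $ fst jl * Y $ snd ik $ snd jl)"

definition diag_mat :: "real^'n \<Rightarrow> real^'n^'n" where
  "diag_mat v = (\<chi> i j. if i = j then v $ i else 0)"

text \<open>The Moore-Penrose inverse, by the four Penrose equations.\<close>

definition is_pinv :: "real^'n^'m \<Rightarrow> real^'m^'n \<Rightarrow> bool" where
  "is_pinv X Y \<longleftrightarrow> X ** Y ** X = X \<and> Y ** X ** Y = Y \<and>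
     transpose (X ** Y) = X ** Y \<and> transpose (Y ** X) = Y ** X"

definition pinv :: "real^'n^'m \<Rightarrow> real^'m^'n" where
  "pinv X = (THE Y. is_pinv X Y)"

definition saddle :: "real^'m^'m \<Rightarrow> real^'m^'n \<Rightarrow> real^'n^'n \<Rightarrow> real^('m + 'n)^('m + 'n)" where
  "saddle A B D = vstack (hstack A (transpose B)) (hstack B D)"

definition Hmat :: "real^'m^'m \<Rightarrow> real^'m^'n \<Rightarrow> real^'n^'n \<Rightarrow> real^('m + 'n)^('m + 'n)" where
  "Hmat A B D = vstack (hstack A 0) (hstack B D)"

text \<open>The matrix \<open>[H d]\<close>; applied to perturbations it gives \<open>[\<Delta>H \<Delta>d]\<close>.\<close>

definition Hd :: "real^'m^'m \<Rightarrow> real^'m^'n \<Rightarrow> real^'n^'n \<Rightarrow> real^'m \<Rightarrow> real^'n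
    \<Rightarrow> real^(('m + 'n) + 1)^('m + 'n)" where
  "Hd A B D f g = hstack (Hmat A B D) (columnvector (vstack f g))"

text \<open>
  The rows of \<open>x\<^sup>T \<otimes> I\<close> are indexed by \<open>1 \<times> _\<close> and those of
  \<open>I \<otimes> y\<^sup>T\<close> by \<open>_ \<times> 1\<close>; the trivial component is dropped.
\<close>

definition Rmat :: "real^'m \<Rightarrow> real^'n
    \<Rightarrow> real^(('m \<times> 'm) + (('m \<times> 'n) + ('n \<times> 'n)))^('m + 'n)" where
  "Rmat x y =
     (let xI_m = (\<chi> i. kron (rowvector x :: real^'m^1) (mat 1 :: real^'m^'m) $ (1, i));
          Iy = (\<chi> i. kron (mat 1 :: real^'m^'m) (rowvector y :: real^'n^1) $ (i, 1));
          xI_n = (\<chi> i. kron (rowvector x :: real^'m^1) (mat 1 :: real^'n^'n) $ (1, i));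
          yI_n = (\<chi> i. kron (rowvector y :: real^'n^1) (mat 1 :: real^'n^'n) $ (1, i))
      in vstack (hstack xI_m (hstack Iy 0)) (hstack 0 (hstack xI_n yI_n)))"

definition vec3 :: "real^'m^'m \<Rightarrow> real^'m^'n \<Rightarrow> real^'n^'n
    \<Rightarrow> real^(('m \<times> 'm) + (('m \<times> 'n) + ('n \<times> 'n)))" where
  "vec3 A B D = vstack (vec_of A) (vstack (vec_of B) (vec_of D))"

text \<open>The equivalence expresses both that \<open>(x + dx, y + dy)\<close> is a solution and that it is the only one.\<close>

definition perturbed_solution where
  "perturbed_solution A B D f g x y dA dB dD df dg dx dy \<longleftrightarrow>
     (\<forall>w. saddle (A + dA) (B + dB) (D + dD) *v w = vstack (f + df) (g + dg)
          \<longleftrightarrow> w = vstack (x + dx) (y + dy))"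

text \<open>
  The suprema are taken in \<open>ereal\<close>. Perturbations for which the perturbed system is not
  uniquely solvable are left out; for a nonsingular saddle point matrix there are none once
  \<open>\<eta>\<close> is small enough, so this does not affect the limits below.
\<close>

definition sup_K :: "real^('m + 'n)^'k \<Rightarrow> real^'m^'m \<Rightarrow> real^'m^'n \<Rightarrow> real^'n^'n
    \<Rightarrow> real^'m \<Rightarrow> real^'n \<Rightarrow> real^'m \<Rightarrow> real^'n \<Rightarrow> real \<Rightarrow> ereal" where
  "sup_K L A B D f g x y \<eta> =
     Sup {ereal (norm (L *v vstack dx dy) / (\<eta> * norm (L *v vstack x y))) | dA dB dD df dg dx dy.
       norm (Hd dA dB dD df dg) \<le> \<eta> * norm (Hd A B D f g) \<and>
       perturbed_solution A B D f g x y dA dB dD df dg dx dy}"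

definition sup_M :: "real^('m + 'n)^'k \<Rightarrow> real^'m^'m \<Rightarrow> real^'m^'n \<Rightarrow> real^'n^'n
    \<Rightarrow> real^'m \<Rightarrow> real^'n \<Rightarrow> real^'m \<Rightarrow> real^'n \<Rightarrow> real \<Rightarrow> ereal" where
  "sup_M L A B D f g x y \<eta> =
     Sup {ereal (infnorm (L *v vstack dx dy) / (\<eta> * infnorm (L *v vstack x y))) | dA dB dD df dg dx dy.
       \<bar>Hd dA dB dD df dg\<bar> \<le> \<eta> *\<^sub>R \<bar>Hd A B D f g\<bar> \<and>
       perturbed_solution A B D f g x y dA dB dD df dg dx dy}"

definition quot :: "real \<Rightarrow> real \<Rightarrow> ereal" where
  "quot a b = (if b = 0 then (if a = 0 then 0 else \<infinity>) else ereal (a / b))"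

definition quot_infnorm :: "real^'k \<Rightarrow> real^'k \<Rightarrow> ereal" where
  "quot_infnorm u v = (SUP i. \<bar>quot (u $ i) (v $ i)\<bar>)"

definition sup_C :: "real^('m + 'n)^'k \<Rightarrow> real^'m^'m \<Rightarrow> real^'m^'n \<Rightarrow> real^'n^'n
    \<Rightarrow> real^'m \<Rightarrow> real^'n \<Rightarrow> real^'m \<Rightarrow> real^'n \<Rightarrow> real \<Rightarrow> ereal" where
  "sup_C L A B D f g x y \<eta> =
     Sup {ereal (1 / \<eta>) * quot_infnorm (L *v vstack dx dy) (L *v vstack x y) | dA dB dD df dg dx dy.
       \<bar>Hd dA dB dD df dg\<bar> \<le> \<eta> *\<^sub>R \<bar>Hd A B D f g\<bar> \<and>
       perturbed_solution A B D f g x y dA dB dD df dg dx dy}"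

definition cond_K where
  "cond_K L A B D f g x y = Lim (at_right 0) (sup_K L A B D f g x y)"

definition cond_M where
  "cond_M L A B D f g x y = Lim (at_right 0) (sup_M L A B D f g x y)"

definition cond_C where
  "cond_C L A B D f g x y = Lim (at_right 0) (sup_C L A B D f g x y)"

end

theory Submission
  imports Defs
begin

text \<open>
  Write \<open>M\<close> for the saddle point matrix and \<open>z\<close> for the solution, and let \<open>E\<close>, \<open>e\<close> be
  perturbations of \<open>M\<close> and of the right-hand side. The perturbed system gives
  \<open>M \<delta> = e - E z - E \<delta>\<close> for the error \<open>\<delta>\<close>, so \<open>\<delta>\<close> is \<open>M\<^sup>-\<^sup>1 (e - E z)\<close> up to a term that is
  quadratic in the size of the perturbation (\<open>perturbed_system_first_order\<close>).
  The identity \<open>E z = Rmat x y (vec3 \<Delta>A \<Delta>B \<Delta>D)\<close> turns the first-order term of \<open>L \<delta>\<close> into \<open>- G q\<close>, where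
  \<open>G = L M\<^sup>-\<^sup>1 [Rmat x y, - I]\<close> and \<open>q\<close> lists the entries of the perturbations (\<open>data_vec\<close>).

  In each of the three definitions the admissible \<open>q\<close> are the multiples by \<open>\<eta>\<close> of the vectors of a fixed
  bounded set, and the error is measured by a Lipschitz function that is absolutely homogeneous.
  Dividing by \<open>\<eta>\<close>, each supremum thus differs by \<open>O(\<eta>)\<close> from the maximum of that function of \<open>G q\<close> over
  the fixed set (\<open>Sup_perturbed_tendsto\<close>).

  It remains to compute these maxima. For the normwise condition number the set is a Euclidean ball, because the
  Frobenius norm of \<open>[\<Delta>H \<Delta>d]\<close> is the norm of \<open>q\<close>, and the maximum is the spectral norm of \<open>G\<close> times the radius
  (\<open>onorm_attained_on_cball\<close>). For the mixed one it is the box \<open>\<bar>q\<bar> \<le> \<bar>q0\<bar>\<close>, where \<open>q0\<close> lists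
  the entries of the data themselves; on it the infinity norm of
  \<open>G q\<close> has as its maximum the infinity norm of \<open>\<bar>G\<bar> \<bar>q0\<bar>\<close>, by a choice of signs
  (\<open>infnorm_attained_on_box\<close>). The componentwise case is the same with \<open>L\<close> replaced by
  its product with the inverse of the diagonal matrix of \<open>L z\<close>.
\<close>

section \<open>Stacked vectors and matrices\<close>

lemma sum_UNIV_Plus:
  fixes h :: "'p::finite + 'q::finite \<Rightarrow> 'a::comm_monoid_add"
  shows "sum h UNIV = (\<Sum>i\<in>UNIV. h (Inl i)) + (\<Sum>j\<in>UNIV. h (Inr j))"
  unfolding UNIV_Plus_UNIV[symmetric] by (subst sum.Plus) (simp_all add: o_def)

lemma vstack_Inl [simp]: "vstack u v $ Inl i = u $ i"
  and vstack_Inr [simp]: "vstack u v $ Inr j = v $ j"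
  by (simp_all add: vstack_def)

lemma hstack_nth [simp]: "hstack X Y $ i = vstack (X $ i) (Y $ i)"
  by (simp add: hstack_def)

lemma vec_of_nth [simp]: "vec_of X $ (j, i) = X $ i $ j"
  by (simp add: vec_of_def)

lemma all_Plus_iff: "(\<forall>k. P k) \<longleftrightarrow> (\<forall>i. P (Inl i)) \<and> (\<forall>j. P (Inr j))"
  by (metis old.sum.exhaust)

lemma vec_eq_Plus_iff:
  fixes u v :: "'a^('p::finite + 'q::finite)"
  shows "u = v \<longleftrightarrow> (\<forall>i. u $ Inl i = v $ Inl i) \<and> (\<forall>j. u $ Inr j = v $ Inr j)"
  by (simp add: vec_eq_iff all_Plus_iff)

lemma vstack_cases:
  fixes w :: "'a^('p::finite + 'q::finite)"
  obtains u v where "w = vstack u v"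
proof
  show "w = vstack (\<chi> i. w $ Inl i) (\<chi> j. w $ Inr j)"
    by (simp add: vec_eq_Plus_iff)
qed

lemma vec_of_cases:
  fixes w :: "'a^('c::finite \<times> 'r::finite)"
  obtains X where "w = vec_of X"
proof
  show "w = vec_of (\<chi> i j. w $ (j, i))"
    by (simp add: vec_eq_iff)
qed

lemma vstack_add: "vstack (u + u') (v + v') = vstack u v + vstack u' v'"
  by (simp add: vec_eq_Plus_iff)

lemma saddle_add: "saddle (A + A') (B + B') (D + D') = saddle A B D + saddle A' B' D'"
  by (simp add: saddle_def vec_eq_Plus_iff vec_eq_iff transpose_def all_conj_distrib)

lemma vstack_mult: "vstack X Y *v u = vstack (X *v u) (Y *v u)"
  by (simp add: vec_eq_Plus_iff matrix_vector_mult_def)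

lemma hstack_mult: "hstack X Y *v vstack u v = X *v u + Y *v v"
  by (simp add: vec_eq_iff matrix_vector_mult_def sum_UNIV_Plus)

lemma norm_vec_square: "(norm v)\<^sup>2 = (\<Sum>i\<in>UNIV. (norm (v $ i))\<^sup>2)"
  by (simp add: norm_vec_def L2_set_def sum_nonneg)

lemma norm_vstack_square: "(norm (vstack u v))\<^sup>2 = (norm u)\<^sup>2 + (norm v)\<^sup>2"
  by (simp add: norm_vec_square sum_UNIV_Plus)

lemma norm_hstack_square: "(norm (hstack X Y))\<^sup>2 = (norm X)\<^sup>2 + (norm Y)\<^sup>2"
proof -
  have "(norm (hstack X Y))\<^sup>2 = (\<Sum>i\<in>UNIV. (norm (X $ i))\<^sup>2 + (norm (Y $ i))\<^sup>2)"
    by (simp add: norm_vec_square[of "hstack X Y"] norm_vstack_square)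
  then show ?thesis
    by (simp add: sum.distrib norm_vec_square[of X] norm_vec_square[of Y])
qed

lemma norm_transpose_square: "(norm (transpose X))\<^sup>2 = (norm (X :: real^'n^'m))\<^sup>2"
proof -
  have "(norm (transpose X))\<^sup>2 = (\<Sum>j\<in>UNIV. \<Sum>i\<in>UNIV. (X $ i $ j)\<^sup>2)"
    by (simp add: norm_vec_square transpose_def)
  also have "\<dots> = (\<Sum>i\<in>UNIV. \<Sum>j\<in>UNIV. (X $ i $ j)\<^sup>2)"
    by (rule sum.swap)
  finally show ?thesis
    by (simp add: norm_vec_square)
qed

lemma norm_vec_of_square: "(norm (vec_of X))\<^sup>2 = (norm (X :: real^'n^'m))\<^sup>2"
proof -
  have "(norm (vec_of X))\<^sup>2 = (\<Sum>j\<in>UNIV. \<Sum>i\<in>UNIV. (X $ i $ j)\<^sup>2)"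
    unfolding norm_vec_square[of "vec_of X"] UNIV_Times_UNIV[symmetric] sum.cartesian_product
    by (rule sum.cong) (auto simp: vec_of_def)
  also have "\<dots> = (norm (transpose X))\<^sup>2"
    by (simp add: norm_vec_square transpose_def)
  finally show ?thesis
    by (simp add: norm_transpose_square)
qed

lemma norm_columnvector_square: "(norm (columnvector v :: real^1^'n))\<^sup>2 = (norm (v :: real^'n))\<^sup>2"
  by (simp add: norm_vec_square columnvector_def)

section \<open>Perturbations as vectors\<close>

text \<open>
  All perturbed data in one vector: the columns of the three matrix blocks, followed by the right-hand
  sides. This is the matrix \<open>Hd\<close> with its zero block deleted and its entries rearranged.
\<close>

definition data_vec :: "real^'m^'m \<Rightarrow> real^'m^'n \<Rightarrow> real^'n^'n \<Rightarrow> real^'m \<Rightarrow> real^'n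
    \<Rightarrow> real^((('m \<times> 'm) + (('m \<times> 'n) + ('n \<times> 'n))) + ('m + 'n))" where
  "data_vec A B D f g = vstack (vec3 A B D) (vstack f g)"

lemma data_vec_cases:
  obtains A B D f g where "q = data_vec A B D f g"
  unfolding data_vec_def vec3_def by (metis vstack_cases vec_of_cases)

lemma norm_data_vec: "norm (data_vec A B D f g) = norm (Hd A B D f g)"
proof (rule power2_eq_imp_eq)
  show "(norm (data_vec A B D f g))\<^sup>2 = (norm (Hd A B D f g))\<^sup>2"
    by (simp add: data_vec_def vec3_def Hd_def Hmat_def norm_vstack_square norm_hstack_square
        norm_vec_of_square norm_columnvector_square)
qed auto

lemma norm_vstack_le_data_vec: "norm (vstack f g) \<le> norm (data_vec A B D f g)"
  by (rule power2_le_imp_le) (simp_all add: data_vec_def norm_vstack_square)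

text \<open>
  The block \<open>B\<close> occurs twice in the saddle point matrix; the factor 2 is more than enough to
  account for this.
\<close>

lemma norm_saddle_le_data_vec: "norm (saddle A B D) \<le> 2 * norm (data_vec A B D f g)"
proof (rule power2_le_imp_le)
  have "(norm (saddle A B D))\<^sup>2 = (norm A)\<^sup>2 + (norm B)\<^sup>2 + ((norm B)\<^sup>2 + (norm D)\<^sup>2)"
    by (simp add: saddle_def norm_vstack_square norm_hstack_square norm_transpose_square)
  also have "(norm A)\<^sup>2 + (norm B)\<^sup>2 + ((norm B)\<^sup>2 + (norm D)\<^sup>2)
      \<le> 4 * ((norm A)\<^sup>2 + ((norm B)\<^sup>2 + (norm D)\<^sup>2) + ((norm f)\<^sup>2 + (norm g)\<^sup>2))"
    by (simp add: algebra_simps)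
  also have "\<dots> = (2 * norm (data_vec A B D f g))\<^sup>2"
    by (simp add: data_vec_def vec3_def norm_vstack_square norm_vec_of_square power_mult_distrib)
  finally show "(norm (saddle A B D))\<^sup>2 \<le> (2 * norm (data_vec A B D f g))\<^sup>2" .
qed simp

lemma abs_data_vec: "\<bar>data_vec A B D f g\<bar> = data_vec \<bar>A\<bar> \<bar>B\<bar> \<bar>D\<bar> \<bar>f\<bar> \<bar>g\<bar>"
  by (simp add: data_vec_def vec3_def vec_eq_iff all_Plus_iff abs_vec_def)

lemma abs_Hd_le_iff:
  "\<bar>Hd A' B' D' f' g'\<bar> \<le> t *\<^sub>R \<bar>Hd A B D f g\<bar> \<longleftrightarrow>
   \<bar>data_vec A' B' D' f' g'\<bar> \<le> t *\<^sub>R \<bar>data_vec A B D f g\<bar>"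
  by (auto simp: data_vec_def vec3_def Hd_def Hmat_def less_eq_vec_def abs_vec_def all_Plus_iff
      columnvector_def)

text \<open>
  The product of a saddle point matrix with a fixed vector is linear in the entries of the blocks,
  and \<open>Rmat x y\<close> is the matrix of this linear map.
\<close>

lemma Rmat_mult_vec3:
  "Rmat x y *v vec3 A B D = saddle A B D *v vstack x y"
proof -
  have prod: "(\<Sum>p\<in>UNIV. h p) = (\<Sum>j\<in>UNIV. \<Sum>i\<in>UNIV. h (j, i))"
    for h :: "'p::finite \<times> 'q::finite \<Rightarrow> real"
    by (simp add: sum.cartesian_product)
  have swap: "(\<Sum>j\<in>UNIV. \<Sum>i\<in>UNIV. if k = j then h i j else 0) = (\<Sum>i\<in>UNIV. h i k)"
    for k and h :: "'q::finite \<Rightarrow> 'p::finite \<Rightarrow> real"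
    by (subst sum.swap) simp
  show ?thesis
    by (simp add: vec_eq_Plus_iff matrix_vector_mult_def sum_UNIV_Plus Rmat_def vec3_def saddle_def
      Let_def prod kron_def rowvector_def mat_def transpose_def mult_ac if_distrib if_distribR
      swap cong: if_cong)
qed

section \<open>First-order expansion of the solution\<close>

lemma norm_matrix_vector_mult_le: "norm (X *v v) \<le> norm X * norm (v :: real^'n)"
  for X :: "real^'n^'m"
proof (rule power2_le_imp_le)
  have "(norm (X *v v))\<^sup>2 = (\<Sum>i\<in>UNIV. (X $ i \<bullet> v)\<^sup>2)"
    by (simp add: norm_vec_square matrix_vector_mul_component)
  also have "\<dots> \<le> (\<Sum>i\<in>UNIV. (norm (X $ i))\<^sup>2 * (norm v)\<^sup>2)"
  proof (rule sum_mono)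
    fix i
    show "(X $ i \<bullet> v)\<^sup>2 \<le> (norm (X $ i))\<^sup>2 * (norm v)\<^sup>2"
      using Cauchy_Schwarz_ineq[of "X $ i" v] by (simp add: power2_norm_eq_inner)
  qed
  also have "\<dots> = (norm X * norm v)\<^sup>2"
    by (simp add: norm_vec_square[of X] sum_distrib_right power_mult_distrib)
  finally show "(norm (X *v v))\<^sup>2 \<le> (norm X * norm v)\<^sup>2" .
qed simp

lemma matrix_inv_mult_left: "invertible M \<Longrightarrow> matrix_inv M ** M = mat 1"
  unfolding invertible_def matrix_inv_def by (rule someI2_ex) auto

text \<open>
  The smallness condition makes \<open>M\<^sup>-\<^sup>1 E\<close> a contraction with factor \<open>1 / 2\<close>. This gives the unique
  solvability of the perturbed system and bounds the error by twice its first-order term.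
\<close>

lemma perturbed_system_first_order:
  fixes M E :: "real^'a^'a" and z d e :: "real^'a"
  assumes M: "invertible M" and z: "M *v z = d"
    and small: "norm (matrix_inv M) * norm E \<le> 1 / 2"
  shows "\<exists>\<delta>. \<forall>w. (M + E) *v w = d + e \<longleftrightarrow> w = z + \<delta>"
    and "(M + E) *v (z + \<delta>) = d + e \<Longrightarrow>
      norm (\<delta> - matrix_inv M *v (e - E *v z))
        \<le> 2 * (norm (matrix_inv M))\<^sup>2 * norm E * (norm e + norm E * norm z)"
proof -
  define W where "W = matrix_inv M"
  have WM: "W *v (M *v v) = v" for v
    using M unfolding W_def by (simp add: matrix_vector_mul_assoc matrix_inv_mult_left)
  have half: "norm (W *v (E *v v)) \<le> norm v / 2" for v
  proof -
    have "norm (W *v (E *v v)) \<le> norm W * norm (E *v v)"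
      by (rule norm_matrix_vector_mult_le)
    also have "\<dots> \<le> norm W * (norm E * norm v)"
      by (intro mult_left_mono norm_matrix_vector_mult_le) simp
    also have "\<dots> \<le> 1 / 2 * norm v"
      using mult_right_mono[OF small, of "norm v"] by (simp add: W_def mult.assoc)
    finally show ?thesis by simp
  qed
  have inj: "inj ((*v) (M + E))"
  proof (rule linear_injective_0[THEN iffD2])
    show "linear ((*v) (M + E))" by simp
    show "\<forall>v. (M + E) *v v = 0 \<longrightarrow> v = 0"
    proof (intro allI impI)
      fix v assume "(M + E) *v v = 0"
      then have "W *v (M *v v) + W *v (E *v v) = 0"
        by (simp add: matrix_vector_mult_add_rdistrib flip: matrix_vector_right_distrib)
      then have "v = - (W *v (E *v v))"
        by (simp add: WM eq_neg_iff_add_eq_0)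
      then have "norm v = norm (W *v (E *v v))"
        by (metis norm_minus_cancel)
      then have "norm v \<le> norm v / 2" using half[of v] by simp
      then show "v = 0" by simp
    qed
  qed
  then have "surj ((*v) (M + E))"
    by (intro linear_injective_imp_surjective) simp_all
  then obtain w0 where w0: "(M + E) *v w0 = d + e"
    by (metis surjD)
  then have "\<forall>w. (M + E) *v w = d + e \<longleftrightarrow> w = z + (w0 - z)"
    using inj_eq[OF inj] by (metis add_diff_cancel_left' diff_add_cancel add.commute)
  then show "\<exists>\<delta>. \<forall>w. (M + E) *v w = d + e \<longleftrightarrow> w = z + \<delta>" ..
  assume "(M + E) *v (z + \<delta>) = d + e"
  then have "M *v \<delta> = (e - E *v z) - E *v \<delta>"
    using z by (simp add: algebra_simps)
  then have \<delta>: "W *v (e - E *v z) - W *v (E *v \<delta>) = \<delta>"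
    by (metis WM matrix_vector_mult_diff_distrib)
  have "norm \<delta> \<le> norm (W *v (e - E *v z)) + norm (W *v (E *v \<delta>))"
    using norm_triangle_ineq4[of "W *v (e - E *v z)" "W *v (E *v \<delta>)"] unfolding \<delta> .
  also have "\<dots> \<le> norm (W *v (e - E *v z)) + norm \<delta> / 2"
    using half by simp
  finally have "norm \<delta> \<le> 2 * norm (W *v (e - E *v z))" by simp
  also have "\<dots> \<le> 2 * (norm W * norm (e - E *v z))"
    by (simp add: norm_matrix_vector_mult_le)
  also have "\<dots> \<le> 2 * (norm W * (norm e + norm E * norm z))"
    by (intro mult_left_mono order_trans[OF norm_triangle_ineq4] add_left_mono
        norm_matrix_vector_mult_le) simp_all
  finally have \<delta>_le: "norm \<delta> \<le> 2 * (norm W * (norm e + norm E * norm z))" .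
  have "\<delta> - W *v (e - E *v z) = - (W *v (E *v \<delta>))"
    using \<delta> by (metis add_diff_cancel_left' diff_add_cancel minus_diff_eq)
  then have "norm (\<delta> - W *v (e - E *v z)) = norm (W *v (E *v \<delta>))"
    by simp
  also have "\<dots> \<le> norm W * norm (E *v \<delta>)"
    by (rule norm_matrix_vector_mult_le)
  also have "\<dots> \<le> norm W * (norm E * norm \<delta>)"
    by (intro mult_left_mono norm_matrix_vector_mult_le) simp
  also have "\<dots> \<le> norm W * (norm E * (2 * (norm W * (norm e + norm E * norm z))))"
    using \<delta>_le by (intro mult_left_mono) simp_all
  finally show "norm (\<delta> - matrix_inv M *v (e - E *v z))
      \<le> 2 * (norm (matrix_inv M))\<^sup>2 * norm E * (norm e + norm E * norm z)"
    by (simp add: W_def power2_eq_square mult_ac)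
qed

text \<open>
  All three condition numbers are limits of this form. The perturbations of relative size \<open>\<eta>\<close> are the
  multiples \<open>\<eta> *\<^sub>R q\<close> with \<open>q \<in> Q\<close>, and \<open>N\<close> measures the error of \<open>L *v vstack x y\<close>. To first order
  this error is \<open>- \<eta> *\<^sub>R (G *v q)\<close>, so that the limit is the maximum of \<open>N (G *v q)\<close> over \<open>Q\<close>, which is
  assumed to be attained at \<open>p\<close>.
\<close>

lemma Sup_perturbed_tendsto:
  fixes A :: "real^'m^'m" and B :: "real^'m^'n" and D :: "real^'n^'n"
    and x f :: "real^'m" and y g :: "real^'n"
    and L :: "real^('m + 'n)^'k" and N :: "real^'k \<Rightarrow> real"
  assumes inv: "invertible (saddle A B D)"
    and sol: "saddle A B D *v vstack x y = vstack f g"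
    and lip: "\<And>u v. \<bar>N u - N v\<bar> \<le> C * norm (u - v)"
    and hom: "\<And>t u. N (t *\<^sub>R u) = \<bar>t\<bar> * N u"
    and bdd: "\<And>q. q \<in> Q \<Longrightarrow> norm q \<le> b"
    and G: "G = L ** matrix_inv (saddle A B D) ** hstack (Rmat x y) (- mat 1)"
    and p: "p \<in> Q" "\<And>q. q \<in> Q \<Longrightarrow> N (G *v q) \<le> N (G *v p)"
  shows "((\<lambda>\<eta>. Sup {ereal (N (L *v vstack dx dy) / \<eta>) | dA dB dD df dg dx dy.
      data_vec dA dB dD df dg \<in> (\<lambda>q. \<eta> *\<^sub>R q) ` Q \<and>
      perturbed_solution A B D f g x y dA dB dD df dg dx dy})
    \<longlongrightarrow> ereal (N (G *v p))) (at_right 0)"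
proof -
  define M W z where "M = saddle A B D" and "W = matrix_inv M" and "z = vstack x y"
  define c where "c = N (G *v p)"
  define S where "S \<eta> = {ereal (N (L *v vstack dx dy) / \<eta>) | dA dB dD df dg dx dy.
      data_vec dA dB dD df dg \<in> (\<lambda>q. \<eta> *\<^sub>R q) ` Q \<and>
      perturbed_solution A B D f g x y dA dB dD df dg dx dy}" for \<eta>
  define K where "K = \<bar>C\<bar> * (norm L * (2 * (norm W)\<^sup>2 * (2 * b) * (b + 2 * b * norm z)))"
  have b: "0 \<le> b"
    using bdd[OF p(1)] norm_ge_zero order_trans by blast
  \<comment> \<open>\<open>K\<close> is the constant that results from the quadratic remainder, with the bounds
    \<open>norm E \<le> 2 * b * \<eta>\<close> and \<open>norm e \<le> b * \<eta>\<close>.\<close>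
  have first_order: "\<bar>N (L *v vstack dx dy) / \<eta> - N (G *v q)\<bar> \<le> K * \<eta>"
    if "0 < \<eta>" "norm W * (2 * b * \<eta>) \<le> 1 / 2" "q \<in> Q" "data_vec dA dB dD df dg = \<eta> *\<^sub>R q"
      and ps: "perturbed_solution A B D f g x y dA dB dD df dg dx dy"
    for \<eta> q dA dB dD df dg dx dy
  proof -
    define E e \<delta> where "E = saddle dA dB dD" and "e = vstack df dg" and "\<delta> = vstack dx dy"
    have nq: "norm (data_vec dA dB dD df dg) \<le> \<eta> * b"
      using that bdd[of q] by simp
    have E: "norm E \<le> 2 * b * \<eta>"
      using norm_saddle_le_data_vec[of dA dB dD df dg] nq by (simp add: E_def mult_ac)
    have e: "norm e \<le> b * \<eta>"
      using norm_vstack_le_data_vec[of df dg dA dB dD] nq by (simp add: e_def mult_ac)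
    have small: "norm (matrix_inv M) * norm E \<le> 1 / 2"
      using that(2) mult_left_mono[OF E, of "norm W"] by (simp add: W_def)
    have sol': "(M + E) *v (z + \<delta>) = vstack f g + e"
      using ps unfolding perturbed_solution_def M_def E_def z_def \<delta>_def e_def
      by (simp add: saddle_add vstack_add)
    have "norm (\<delta> - W *v (e - E *v z)) \<le> 2 * (norm W)\<^sup>2 * norm E * (norm e + norm E * norm z)"
      using perturbed_system_first_order(2)[OF _ _ small sol'] inv sol
      by (simp add: M_def W_def z_def)
    also have "\<dots> \<le> 2 * (norm W)\<^sup>2 * (2 * b * \<eta>) * (b * \<eta> + 2 * b * \<eta> * norm z)"
      using E e b that(1) by (intro mult_mono add_mono) simp_all
    finally have rem: "norm (\<delta> - W *v (e - E *v z))
        \<le> 2 * (norm W)\<^sup>2 * (2 * b * \<eta>) * (b * \<eta> + 2 * b * \<eta> * norm z)" .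
    have "\<eta> *\<^sub>R (G *v q) = G *v data_vec dA dB dD df dg"
      using that(4) by (simp add: matrix_vector_mult_scaleR)
    also have "\<dots> = L *v (W *v (hstack (Rmat x y) (- mat 1) *v vstack (vec3 dA dB dD) e))"
      by (simp add: G W_def M_def data_vec_def e_def matrix_vector_mul_assoc matrix_mul_assoc)
    also have "hstack (Rmat x y) (- mat 1) *v vstack (vec3 dA dB dD) e = - (e - E *v z)"
      by (simp add: hstack_mult Rmat_mult_vec3 E_def z_def
          matrix_vector_mult_diff_rdistrib[of 0 "mat 1", simplified])
    finally have Gq: "(- \<eta>) *\<^sub>R (G *v q) = L *v (W *v (e - E *v z))"
      by (simp add: matrix_vector_mult_diff_distrib)
    have "\<bar>N (L *v \<delta>) - \<eta> * N (G *v q)\<bar> = \<bar>N (L *v \<delta>) - N ((- \<eta>) *\<^sub>R (G *v q))\<bar>"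
      using that(1) by (simp only: hom abs_minus_cancel abs_of_pos)
    also have "\<dots> \<le> C * norm (L *v \<delta> - L *v (W *v (e - E *v z)))"
      unfolding Gq by (rule lip)
    also have "\<dots> \<le> \<bar>C\<bar> * (norm L * norm (\<delta> - W *v (e - E *v z)))"
      unfolding matrix_vector_mult_diff_distrib[symmetric]
      by (intro mult_mono norm_matrix_vector_mult_le) simp_all
    also have "\<dots> \<le> \<bar>C\<bar> * (norm L * (2 * (norm W)\<^sup>2 * (2 * b * \<eta>) * (b * \<eta> + 2 * b * \<eta> * norm z)))"
      by (intro mult_left_mono rem) simp_all
    also have "\<dots> = K * \<eta> * \<eta>"
      by (simp add: K_def algebra_simps)
    finally have "\<bar>N (L *v \<delta>) - \<eta> * N (G *v q)\<bar> \<le> K * \<eta> * \<eta>" .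
    moreover have "N (L *v \<delta>) / \<eta> - N (G *v q) = (N (L *v \<delta>) - \<eta> * N (G *v q)) / \<eta>"
      using that(1) by (simp add: field_simps)
    ultimately show ?thesis
      using that(1) by (simp add: abs_divide divide_le_eq \<delta>_def)
  qed
  have small_ev: "\<forall>\<^sub>F \<eta> in at_right 0. 0 < \<eta> \<and> norm W * (2 * b * \<eta>) \<le> 1 / 2"
  proof (intro eventually_conj eventually_at_right_less)
    have "((\<lambda>\<eta>. norm W * (2 * b * \<eta>)) \<longlongrightarrow> norm W * (2 * b * 0)) (at_right 0)"
      by (intro tendsto_intros)
    then have "\<forall>\<^sub>F \<eta> in at_right 0. norm W * (2 * b * \<eta>) < 1 / 2"
      by (rule order_tendstoD) simp
    then show "\<forall>\<^sub>F \<eta> in at_right 0. norm W * (2 * b * \<eta>) \<le> 1 / 2"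
      by (rule eventually_mono) simp
  qed
  have upper: "Sup (S \<eta>) \<le> ereal (c + K * \<eta>)" if "0 < \<eta> \<and> norm W * (2 * b * \<eta>) \<le> 1 / 2" for \<eta>
  proof (rule Sup_least)
    fix s assume "s \<in> S \<eta>"
    then obtain dA dB dD df dg dx dy q where
      s: "s = ereal (N (L *v vstack dx dy) / \<eta>)" and q: "q \<in> Q"
      and *: "data_vec dA dB dD df dg = \<eta> *\<^sub>R q"
        "perturbed_solution A B D f g x y dA dB dD df dg dx dy"
      unfolding S_def by blast
    show "s \<le> ereal (c + K * \<eta>)"
      using first_order[OF _ _ q *] that p(2)[OF q] by (simp add: s c_def)
  qed
  have lower: "ereal (c - K * \<eta>) \<le> Sup (S \<eta>)" if "0 < \<eta> \<and> norm W * (2 * b * \<eta>) \<le> 1 / 2" for \<eta>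
  proof -
    obtain dA dB dD df dg where q: "\<eta> *\<^sub>R p = data_vec dA dB dD df dg"
      by (rule data_vec_cases)
    have "norm (\<eta> *\<^sub>R p) \<le> \<eta> * b"
      using bdd[OF p(1)] that by simp
    then have "norm (saddle dA dB dD) \<le> 2 * b * \<eta>"
      using norm_saddle_le_data_vec[of dA dB dD df dg] by (simp add: q mult_ac)
    then have small: "norm (matrix_inv M) * norm (saddle dA dB dD) \<le> 1 / 2"
      using that mult_left_mono[of "norm (saddle dA dB dD)" "2 * b * \<eta>" "norm W"]
      by (simp add: W_def)
    then obtain \<delta> where \<delta>: "\<And>w. (M + saddle dA dB dD) *v w = vstack f g + vstack df dg
        \<longleftrightarrow> w = z + \<delta>"
      using perturbed_system_first_order(1)[OF _ _ small] inv sol unfolding M_def z_def by metis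
    obtain dx dy where "\<delta> = vstack dx dy"
      by (rule vstack_cases)
    with \<delta> have ps: "perturbed_solution A B D f g x y dA dB dD df dg dx dy"
      by (simp add: perturbed_solution_def saddle_add vstack_add M_def z_def)
    have "c - K * \<eta> \<le> N (L *v vstack dx dy) / \<eta>"
      using first_order[OF _ _ p(1) q[symmetric] ps] that by (simp add: c_def)
    moreover have "ereal (N (L *v vstack dx dy) / \<eta>) \<in> S \<eta>"
      unfolding S_def using ps p(1) q by (metis (mono_tags, lifting) image_eqI mem_Collect_eq)
    ultimately show ?thesis
      by (meson Sup_upper2 ereal_less_eq(3))
  qed
  have "((\<lambda>\<eta>. Sup (S \<eta>)) \<longlongrightarrow> ereal c) (at_right 0)"
  proof (rule tendsto_sandwich)
    show "\<forall>\<^sub>F \<eta> in at_right 0. ereal (c - K * \<eta>) \<le> Sup (S \<eta>)"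
      using small_ev by (rule eventually_mono) (rule lower)
    show "\<forall>\<^sub>F \<eta> in at_right 0. Sup (S \<eta>) \<le> ereal (c + K * \<eta>)"
      using small_ev by (rule eventually_mono) (rule upper)
    have "((\<lambda>\<eta>. c - K * \<eta>) \<longlongrightarrow> c - K * 0) (at_right 0)"
      and "((\<lambda>\<eta>. c + K * \<eta>) \<longlongrightarrow> c + K * 0) (at_right 0)"
      by (intro tendsto_intros)+
    then show "((\<lambda>\<eta>. ereal (c - K * \<eta>)) \<longlongrightarrow> ereal c) (at_right 0)"
      and "((\<lambda>\<eta>. ereal (c + K * \<eta>)) \<longlongrightarrow> ereal c) (at_right 0)"
      by (simp_all add: tendsto_ereal)
  qed
  then show ?thesis
    by (simp add: S_def c_def)
qed

section \<open>Maximal errors over balls and boxes\<close>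

lemma onorm_attained_on_cball:
  fixes G :: "real^'q^'k"
  assumes "0 \<le> r"
  obtains p where "norm p \<le> r" "norm (G *v p) = onorm ((*v) G) * r"
    and "\<And>q. norm q \<le> r \<Longrightarrow> norm (G *v q) \<le> onorm ((*v) G) * r"
proof -
  have bl: "bounded_linear ((*v) G)" by simp
  have "continuous_on (cball 0 1) (\<lambda>q. norm (G *v q))"
    by (intro continuous_on_norm linear_continuous_on bl)
  then obtain u where u: "norm u \<le> 1" "\<And>v. norm v \<le> 1 \<Longrightarrow> norm (G *v v) \<le> norm (G *v u)"
    using continuous_attains_sup[of "cball 0 1" "\<lambda>q. norm (G *v q)"] by auto
  have "onorm ((*v) G) \<le> norm (G *v u)"
  proof (rule onorm_bound)
    fix v
    show "norm (G *v v) \<le> norm (G *v u) * norm v"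
    proof (cases "v = 0")
      case False
      then show ?thesis
        using u(2)[of "(1 / norm v) *\<^sub>R v"]
        by (simp add: matrix_vector_mult_scaleR divide_simps)
    qed simp
  qed simp
  moreover have "norm (G *v v) \<le> onorm ((*v) G) * s" if "norm v \<le> s" for v s
    using onorm[OF bl, of v] mult_left_mono[OF that onorm_pos_le[OF bl]] by simp
  ultimately have "norm (G *v u) = onorm ((*v) G)"
    using u(1) by (metis antisym mult.right_neutral)
  then show thesis
    using that[of "r *\<^sub>R u"] assms u(1) \<open>\<And>v s. norm v \<le> s \<Longrightarrow> norm (G *v v) \<le> onorm ((*v) G) * s\<close>
    by (simp add: matrix_vector_mult_scaleR mult_left_le mult.commute)
qed

lemma infnorm_le_iff_cart: "infnorm (x :: real^'n) \<le> c \<longleftrightarrow> (\<forall>i. \<bar>x $ i\<bar> \<le> c)"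
proof
  assume "\<forall>i. \<bar>x $ i\<bar> \<le> c"
  then show "infnorm x \<le> c"
    unfolding infnorm_cart by (intro cSup_least) auto
qed (use component_le_infnorm_cart order_trans in blast)

lemma infnorm_attained_cart:
  obtains i where "infnorm (x :: real^'n) = \<bar>x $ i\<bar>"
proof -
  have "Max (range (\<lambda>i. \<bar>x $ i\<bar>)) \<in> range (\<lambda>i. \<bar>x $ i\<bar>)"
    by (rule Max_in) auto
  then obtain i where "\<bar>x $ i\<bar> = Max (range (\<lambda>i. \<bar>x $ i\<bar>))"
    by (metis imageE)
  then have "infnorm x \<le> \<bar>x $ i\<bar>"
    by (simp add: infnorm_le_iff_cart)
  then show thesis
    by (intro that antisym component_le_infnorm_cart)
qed

text \<open>On the box of vectors dominated by \<open>q0\<close>, row \<open>i\<close> of \<open>G\<close> takes values up to \<open>(\<bar>G\<bar> *v \<bar>q0\<bar>) $ i\<close>.\<close>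

lemma infnorm_attained_on_box:
  fixes G :: "real^'q^'k" and q0 :: "real^'q"
  obtains p where "\<bar>p\<bar> \<le> \<bar>q0\<bar>" "infnorm (G *v p) = infnorm (\<bar>G\<bar> *v \<bar>q0\<bar>)"
    and "\<And>q. \<bar>q\<bar> \<le> \<bar>q0\<bar> \<Longrightarrow> infnorm (G *v q) \<le> infnorm (\<bar>G\<bar> *v \<bar>q0\<bar>)"
proof -
  define h where "h = \<bar>G\<bar> *v \<bar>q0\<bar>"
  have h: "h $ i = (\<Sum>j\<in>UNIV. \<bar>G $ i $ j\<bar> * \<bar>q0 $ j\<bar>)" for i
    by (simp add: h_def matrix_vector_mult_def abs_vec_def)
  have le: "infnorm (G *v q) \<le> infnorm h" if "\<bar>q\<bar> \<le> \<bar>q0\<bar>" for q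
    unfolding infnorm_le_iff_cart
  proof
    fix i
    have "\<bar>(G *v q) $ i\<bar> \<le> (\<Sum>j\<in>UNIV. \<bar>G $ i $ j * q $ j\<bar>)"
      by (simp add: matrix_vector_mult_def sum_abs)
    also have "\<dots> \<le> h $ i"
      unfolding h abs_mult using that
      by (intro sum_mono mult_left_mono) (auto simp: less_eq_vec_def abs_vec_def)
    also have "\<dots> \<le> infnorm h"
      using component_le_infnorm_cart[of h i] by simp
    finally show "\<bar>(G *v q) $ i\<bar> \<le> infnorm h" .
  qed
  obtain i where i: "infnorm h = \<bar>h $ i\<bar>"
    by (rule infnorm_attained_cart)
  \<comment> \<open>The signs of the entries of a maximal row make all terms of its product with \<open>p\<close> nonnegative.\<close>
  define p where "p = (\<chi> j. sgn (G $ i $ j) * \<bar>q0 $ j\<bar>)"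
  have p: "\<bar>p\<bar> \<le> \<bar>q0\<bar>"
    by (auto simp: p_def less_eq_vec_def abs_vec_def abs_mult abs_sgn_eq)
  have "(G *v p) $ i = h $ i"
    by (simp add: matrix_vector_mult_def p_def h mult.assoc[symmetric] abs_sgn)
  then have "infnorm h \<le> infnorm (G *v p)"
    using component_le_infnorm_cart[of "G *v p" i] i by simp
  then show thesis
    using that[OF p] le[OF p] le by (simp add: h_def)
qed

lemma scaled_box:
  assumes "0 < t"
  shows "\<bar>q :: real^'q\<bar> \<le> t *\<^sub>R \<bar>q0\<bar> \<longleftrightarrow> q \<in> (\<lambda>q. t *\<^sub>R q) ` {q. \<bar>q\<bar> \<le> \<bar>q0\<bar>}"
proof
  assume "\<bar>q\<bar> \<le> t *\<^sub>R \<bar>q0\<bar>"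
  then have "q = t *\<^sub>R ((1 / t) *\<^sub>R q)" "\<bar>(1 / t) *\<^sub>R q\<bar> \<le> \<bar>q0\<bar>"
    using assms by (auto simp: less_eq_vec_def abs_vec_def abs_mult divide_simps mult_ac)
  then show "q \<in> (\<lambda>q. t *\<^sub>R q) ` {q. \<bar>q\<bar> \<le> \<bar>q0\<bar>}"
    by blast
next
  assume "q \<in> (\<lambda>q. t *\<^sub>R q) ` {q. \<bar>q\<bar> \<le> \<bar>q0\<bar>}"
  then show "\<bar>q\<bar> \<le> t *\<^sub>R \<bar>q0\<bar>"
    using assms by (auto simp: less_eq_vec_def abs_vec_def abs_mult)
qed

lemma scaled_cball:
  fixes q :: "'a::real_normed_vector"
  assumes "0 < t"
  shows "norm q \<le> t * r \<longleftrightarrow> q \<in> (\<lambda>q. t *\<^sub>R q) ` {q. norm q \<le> r}"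
proof
  assume "norm q \<le> t * r"
  then have "q = t *\<^sub>R ((1 / t) *\<^sub>R q)" "norm ((1 / t) *\<^sub>R q) \<le> r"
    using assms by (auto simp: divide_simps mult_ac)
  then show "q \<in> (\<lambda>q. t *\<^sub>R q) ` {q. norm q \<le> r}"
    by blast
qed (use assms in auto)

lemma norm_le_if_abs_le:
  assumes "\<bar>q :: real^'q\<bar> \<le> \<bar>q0\<bar>"
  shows "norm q \<le> norm q0"
  using assms by (intro norm_le_componentwise_cart) (auto simp: less_eq_vec_def abs_vec_def)

section \<open>Componentwise quotients\<close>

lemma diag_mat_mult_nth: "(diag_mat v *v u) $ i = v $ i * u $ i"
  by (simp add: diag_mat_def matrix_vector_mult_def if_distrib if_distribR sum.delta cong: if_cong)

lemma diag_mat_mult_matrix_nth: "(diag_mat v ** X) $ i $ j = v $ i * X $ i $ j"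
  by (simp add: diag_mat_def matrix_matrix_mult_def if_distrib if_distribR sum.delta cong: if_cong)

lemma diag_mat_mult_diag_mat: "diag_mat u ** diag_mat v = diag_mat (\<chi> i. u $ i * v $ i)"
  unfolding vec_eq_iff diag_mat_mult_matrix_nth by (simp add: diag_mat_def)

lemma pinv_diag_mat:
  assumes "\<And>i. v $ i \<noteq> 0"
  shows "pinv (diag_mat v) = diag_mat (\<chi> i. 1 / v $ i)"
  unfolding pinv_def
proof (rule the_equality)
  let ?D = "diag_mat v" and ?I = "diag_mat (\<chi> i. 1 / v $ i)"
  have unit: "diag_mat (\<chi> i. 1) = mat 1"
    by (simp add: diag_mat_def mat_def vec_eq_iff)
  have one: "?D ** ?I = mat 1" "?I ** ?D = mat 1"
    using assms by (simp_all add: diag_mat_mult_diag_mat unit)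
  show "is_pinv ?D ?I"
    unfolding is_pinv_def one by simp
  fix Y assume "is_pinv ?D Y"
  then have Y: "?D ** Y ** ?D = ?D"
    by (simp only: is_pinv_def)
  have "Y = (?I ** ?D) ** Y ** (?D ** ?I)"
    unfolding one by simp
  also have "\<dots> = ?I ** (?D ** Y ** ?D) ** ?I"
    by (simp only: matrix_mul_assoc)
  also have "\<dots> = ?I"
    unfolding Y one by simp
  finally show "Y = ?I" .
qed

lemma quot_infnorm_eq:
  fixes u v :: "real^'k"
  assumes "\<And>i. v $ i \<noteq> 0"
  shows "quot_infnorm u v = ereal (infnorm (pinv (diag_mat v) *v u))"
proof -
  have q: "\<bar>quot (u $ i) (v $ i)\<bar> = ereal \<bar>(pinv (diag_mat v) *v u) $ i\<bar>" for i
    using assms by (simp add: quot_def pinv_diag_mat diag_mat_mult_nth)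
  show ?thesis
    unfolding quot_infnorm_def q
  proof (rule antisym)
    show "(SUP i. ereal \<bar>(pinv (diag_mat v) *v u) $ i\<bar>) \<le> ereal (infnorm (pinv (diag_mat v) *v u))"
      by (rule SUP_least) (simp add: component_le_infnorm_cart)
    obtain i where "infnorm (pinv (diag_mat v) *v u) = \<bar>(pinv (diag_mat v) *v u) $ i\<bar>"
      by (rule infnorm_attained_cart)
    then show "ereal (infnorm (pinv (diag_mat v) *v u)) \<le> (SUP i. ereal \<bar>(pinv (diag_mat v) *v u) $ i\<bar>)"
      by (metis SUP_upper UNIV_I)
  qed
qed

text \<open>Row scaling may change the signs of the rows, which the infinity norm does not see.\<close>

lemma infnorm_abs_diag_mat_mult:
  fixes G :: "real^'q^'k" and q :: "real^'q"
  shows "infnorm (\<bar>diag_mat v ** G\<bar> *v \<bar>q\<bar>) = infnorm (diag_mat v *v (\<bar>G\<bar> *v \<bar>q\<bar>))"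
proof -
  have "\<bar>(\<bar>diag_mat v ** G\<bar> *v \<bar>q\<bar>) $ i\<bar> = \<bar>(diag_mat v *v (\<bar>G\<bar> *v \<bar>q\<bar>)) $ i\<bar>" for i
  proof -
    have "(\<bar>diag_mat v ** G\<bar> *v \<bar>q\<bar>) $ i = \<bar>v $ i\<bar> * (\<bar>G\<bar> *v \<bar>q\<bar>) $ i"
      by (simp add: matrix_vector_mult_def abs_vec_def diag_mat_mult_matrix_nth abs_mult sum_distrib_left mult.assoc)
    then show ?thesis
      by (simp add: diag_mat_mult_nth abs_mult)
  qed
  then show ?thesis
    by (simp add: infnorm_cart)
qed

section \<open>The condition numbers\<close>

lemma abs_mult_hstack_neg_mat:
  fixes Y :: "real^'p^'k" and X :: "real^'q^'p"
  shows "\<bar>Y ** hstack X (- mat 1)\<bar> = hstack \<bar>Y ** X\<bar> \<bar>Y\<bar>"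
  by (simp add: vec_eq_iff[where 'b='k] vec_eq_Plus_iff abs_vec_def matrix_matrix_mult_def mat_def
      if_distrib if_distribR sum.delta sum_negf cong: if_cong)

lemma tendsto_imp_Lim_at_right:
  fixes F :: "real \<Rightarrow> 'a::t2_space"
  assumes "(F \<longlongrightarrow> c) (at_right 0)"
  shows "(F \<longlongrightarrow> Lim (at_right 0) F) (at_right 0) \<and> Lim (at_right 0) F = c"
  using assms tendsto_Lim[OF _ assms] by (simp add: trivial_limit_at_right_real)

theorem theorem3p1:
  fixes A :: "real^'m^'m" and B :: "real^'m^'n" and D :: "real^'n^'n"
    and x f :: "real^'m" and y g :: "real^'n"
    and L :: "real^('m + 'n)^'k"
  assumes "invertible A"
    and "invertible (saddle A B D)"
    and "saddle A B D *v vstack x y = vstack f g"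
    and "L *v vstack x y \<noteq> 0"
  shows "let Minv = matrix_inv (saddle A B D); Lz = L *v vstack x y in
    (sup_K L A B D f g x y \<longlongrightarrow> cond_K L A B D f g x y) (at_right 0) \<and>
    cond_K L A B D f g x y =
      ereal (onorm ((*v) (L ** Minv ** hstack (Rmat x y) (- mat 1))) * norm (Hd A B D f g)
             / norm Lz) \<and>
    (sup_M L A B D f g x y \<longlongrightarrow> cond_M L A B D f g x y) (at_right 0) \<and>
    cond_M L A B D f g x y =
      ereal (infnorm (\<bar>L ** Minv ** Rmat x y\<bar> *v vec3 \<bar>A\<bar> \<bar>B\<bar> \<bar>D\<bar>
                      + \<bar>L ** Minv\<bar> *v vstack \<bar>f\<bar> \<bar>g\<bar>)
             / infnorm Lz) \<and>
    ((\<forall>i. Lz $ i \<noteq> 0) \<longrightarrow>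
      (sup_C L A B D f g x y \<longlongrightarrow> cond_C L A B D f g x y) (at_right 0) \<and>
      cond_C L A B D f g x y =
        ereal (infnorm (pinv (diag_mat Lz) ** \<bar>L ** Minv ** Rmat x y\<bar> *v vec3 \<bar>A\<bar> \<bar>B\<bar> \<bar>D\<bar>
                        + pinv (diag_mat Lz) ** \<bar>L ** Minv\<bar> *v vstack \<bar>f\<bar> \<bar>g\<bar>)))"
proof -
  define Minv Lz where "Minv = matrix_inv (saddle A B D)" and "Lz = L *v vstack x y"
  define G where "G = L ** Minv ** hstack (Rmat x y) (- mat 1)"
  define q0 where "q0 = data_vec A B D f g"
  define v where "v = \<bar>G\<bar> *v \<bar>q0\<bar>"
  note conv = Sup_perturbed_tendsto[OF assms(2,3)]
  have v: "v = \<bar>L ** Minv ** Rmat x y\<bar> *v vec3 \<bar>A\<bar> \<bar>B\<bar> \<bar>D\<bar> + \<bar>L ** Minv\<bar> *v vstack \<bar>f\<bar> \<bar>g\<bar>"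
    unfolding v_def q0_def G_def abs_mult_hstack_neg_mat abs_data_vec
    unfolding data_vec_def hstack_mult ..
  have K: "(sup_K L A B D f g x y \<longlongrightarrow> ereal (onorm ((*v) G) * norm q0 / norm Lz)) (at_right 0)"
  proof -
    obtain p where p: "norm p \<le> norm q0" "norm (G *v p) = onorm ((*v) G) * norm q0"
      "\<And>q. norm q \<le> norm q0 \<Longrightarrow> norm (G *v q) \<le> onorm ((*v) G) * norm q0"
      using onorm_attained_on_cball[OF norm_ge_zero] by metis
    have "((\<lambda>\<eta>. Sup {ereal (norm (L *v vstack dx dy) / norm Lz / \<eta>) | dA dB dD df dg dx dy.
        data_vec dA dB dD df dg \<in> (\<lambda>q. \<eta> *\<^sub>R q) ` {q. norm q \<le> norm q0} \<and>
        perturbed_solution A B D f g x y dA dB dD df dg dx dy})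
      \<longlongrightarrow> ereal (norm (G *v p) / norm Lz)) (at_right 0)"
    proof (rule conv[where N="\<lambda>u. norm u / norm Lz" and C="1 / norm Lz" and b="norm q0"])
      fix u w :: "real^'k"
      show "\<bar>norm u / norm Lz - norm w / norm Lz\<bar> \<le> 1 / norm Lz * norm (u - w)"
        using norm_triangle_ineq3[of u w]
        by (simp add: diff_divide_distrib[symmetric] abs_divide divide_right_mono)
    qed (use p in \<open>auto simp: G_def Minv_def intro!: divide_right_mono\<close>)
    then have lim: "((\<lambda>\<eta>. Sup {ereal (norm (L *v vstack dx dy) / norm Lz / \<eta>) | dA dB dD df dg dx dy.
        data_vec dA dB dD df dg \<in> (\<lambda>q. \<eta> *\<^sub>R q) ` {q. norm q \<le> norm q0} \<and>
        perturbed_solution A B D f g x y dA dB dD df dg dx dy})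
      \<longlongrightarrow> ereal (onorm ((*v) G) * norm q0 / norm Lz)) (at_right 0)"
      by (simp only: p(2))
    show ?thesis
    proof (rule Lim_transform_eventually[OF lim eventually_at_rightI[of 0 1]])
      fix \<eta> :: real assume "\<eta> \<in> {0<..<1}"
      then have \<eta>: "0 < \<eta>" by simp
      show "Sup {ereal (norm (L *v vstack dx dy) / norm Lz / \<eta>) | dA dB dD df dg dx dy.
          data_vec dA dB dD df dg \<in> (\<lambda>q. \<eta> *\<^sub>R q) ` {q. norm q \<le> norm q0} \<and>
          perturbed_solution A B D f g x y dA dB dD df dg dx dy} = sup_K L A B D f g x y \<eta>"
        unfolding sup_K_def scaled_cball[OF \<eta>, symmetric] norm_data_vec q0_def Lz_def
          divide_divide_eq_left mult.commute[of _ \<eta>] ..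
    qed simp
  qed
  have M: "(sup_M L A B D f g x y \<longlongrightarrow> ereal (infnorm v / infnorm Lz)) (at_right 0)"
  proof -
    obtain p where p: "\<bar>p\<bar> \<le> \<bar>q0\<bar>" "infnorm (G *v p) = infnorm v"
      "\<And>q. \<bar>q\<bar> \<le> \<bar>q0\<bar> \<Longrightarrow> infnorm (G *v q) \<le> infnorm v"
      unfolding v_def using infnorm_attained_on_box by metis
    have "((\<lambda>\<eta>. Sup {ereal (infnorm (L *v vstack dx dy) / infnorm Lz / \<eta>) | dA dB dD df dg dx dy.
        data_vec dA dB dD df dg \<in> (\<lambda>q. \<eta> *\<^sub>R q) ` {q. \<bar>q\<bar> \<le> \<bar>q0\<bar>} \<and>
        perturbed_solution A B D f g x y dA dB dD df dg dx dy})
      \<longlongrightarrow> ereal (infnorm (G *v p) / infnorm Lz)) (at_right 0)"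
    proof (rule conv[where N="\<lambda>u. infnorm u / infnorm Lz" and C="1 / infnorm Lz" and b="norm q0"])
      fix u w :: "real^'k"
      show "\<bar>infnorm u / infnorm Lz - infnorm w / infnorm Lz\<bar> \<le> 1 / infnorm Lz * norm (u - w)"
        using order_trans[OF absdiff_infnorm[of u w] infnorm_le_norm]
        by (simp add: diff_divide_distrib[symmetric] abs_divide real_abs_infnorm divide_right_mono
            infnorm_pos_le)
    qed (use p in \<open>auto simp: G_def Minv_def infnorm_mul infnorm_pos_le norm_le_if_abs_le
        intro!: divide_right_mono\<close>)
    then have lim: "((\<lambda>\<eta>. Sup {ereal (infnorm (L *v vstack dx dy) / infnorm Lz / \<eta>) | dA dB dD df dg dx dy.
        data_vec dA dB dD df dg \<in> (\<lambda>q. \<eta> *\<^sub>R q) ` {q. \<bar>q\<bar> \<le> \<bar>q0\<bar>} \<and>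
        perturbed_solution A B D f g x y dA dB dD df dg dx dy})
      \<longlongrightarrow> ereal (infnorm v / infnorm Lz)) (at_right 0)"
      by (simp only: p(2))
    show ?thesis
    proof (rule Lim_transform_eventually[OF lim eventually_at_rightI[of 0 1]])
      fix \<eta> :: real assume "\<eta> \<in> {0<..<1}"
      then have \<eta>: "0 < \<eta>" by simp
      show "Sup {ereal (infnorm (L *v vstack dx dy) / infnorm Lz / \<eta>) | dA dB dD df dg dx dy.
          data_vec dA dB dD df dg \<in> (\<lambda>q. \<eta> *\<^sub>R q) ` {q. \<bar>q\<bar> \<le> \<bar>q0\<bar>} \<and>
          perturbed_solution A B D f g x y dA dB dD df dg dx dy} = sup_M L A B D f g x y \<eta>"
        unfolding sup_M_def scaled_box[OF \<eta>, symmetric] abs_Hd_le_iff q0_def Lz_def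
          divide_divide_eq_left mult.commute[of _ \<eta>] ..
    qed simp
  qed
  have C: "(sup_C L A B D f g x y \<longlongrightarrow> ereal (infnorm (pinv (diag_mat Lz) *v v))) (at_right 0)"
    if nz: "\<forall>i. Lz $ i \<noteq> 0"
  proof -
    \<comment> \<open>The componentwise quotient by \<open>Lz\<close> is the product with \<open>P\<close>, so the limit lemma applies with
      \<open>P ** L\<close> in place of \<open>L\<close>.\<close>
    define P where "P = pinv (diag_mat Lz)"
    have "P = diag_mat (\<chi> i. 1 / Lz $ i)"
      using nz by (simp add: P_def pinv_diag_mat)
    then have Pv: "infnorm (\<bar>P ** G\<bar> *v \<bar>q0\<bar>) = infnorm (P *v v)"
      by (simp add: infnorm_abs_diag_mat_mult v_def)
    obtain p where p: "\<bar>p\<bar> \<le> \<bar>q0\<bar>" "infnorm ((P ** G) *v p) = infnorm (P *v v)"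
      "\<And>q. \<bar>q\<bar> \<le> \<bar>q0\<bar> \<Longrightarrow> infnorm ((P ** G) *v q) \<le> infnorm (P *v v)"
      unfolding Pv[symmetric] using infnorm_attained_on_box by metis
    have "((\<lambda>\<eta>. Sup {ereal (infnorm ((P ** L) *v vstack dx dy) / \<eta>) | dA dB dD df dg dx dy.
        data_vec dA dB dD df dg \<in> (\<lambda>q. \<eta> *\<^sub>R q) ` {q. \<bar>q\<bar> \<le> \<bar>q0\<bar>} \<and>
        perturbed_solution A B D f g x y dA dB dD df dg dx dy})
      \<longlongrightarrow> ereal (infnorm ((P ** G) *v p))) (at_right 0)"
    proof (rule conv[where N=infnorm and C=1 and b="norm q0"])
      fix u w :: "real^'k"
      show "\<bar>infnorm u - infnorm w\<bar> \<le> 1 * norm (u - w)"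
        using order_trans[OF absdiff_infnorm[of u w] infnorm_le_norm] by simp
    qed (use p in \<open>auto simp: G_def Minv_def infnorm_mul norm_le_if_abs_le matrix_mul_assoc\<close>)
    then have lim: "((\<lambda>\<eta>. Sup {ereal (infnorm ((P ** L) *v vstack dx dy) / \<eta>) | dA dB dD df dg dx dy.
        data_vec dA dB dD df dg \<in> (\<lambda>q. \<eta> *\<^sub>R q) ` {q. \<bar>q\<bar> \<le> \<bar>q0\<bar>} \<and>
        perturbed_solution A B D f g x y dA dB dD df dg dx dy})
      \<longlongrightarrow> ereal (infnorm (P *v v))) (at_right 0)"
      by (simp only: p(2))
    have quot: "ereal (1 / \<eta>) * quot_infnorm (L *v w) (L *v vstack x y)
        = ereal (infnorm ((P ** L) *v w) / \<eta>)" for \<eta> w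
      using nz quot_infnorm_eq[of Lz "L *v w"] by (simp add: Lz_def P_def matrix_vector_mul_assoc)
    show ?thesis
      unfolding P_def[symmetric]
    proof (rule Lim_transform_eventually[OF lim eventually_at_rightI[of 0 1]])
      fix \<eta> :: real assume "\<eta> \<in> {0<..<1}"
      then have \<eta>: "0 < \<eta>" by simp
      show "Sup {ereal (infnorm ((P ** L) *v vstack dx dy) / \<eta>) | dA dB dD df dg dx dy.
          data_vec dA dB dD df dg \<in> (\<lambda>q. \<eta> *\<^sub>R q) ` {q. \<bar>q\<bar> \<le> \<bar>q0\<bar>} \<and>
          perturbed_solution A B D f g x y dA dB dD df dg dx dy} = sup_C L A B D f g x y \<eta>"
        unfolding sup_C_def scaled_box[OF \<eta>, symmetric] abs_Hd_le_iff q0_def quot ..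
    qed simp
  qed
  have Pv: "pinv (diag_mat Lz) *v v =
      pinv (diag_mat Lz) ** \<bar>L ** Minv ** Rmat x y\<bar> *v vec3 \<bar>A\<bar> \<bar>B\<bar> \<bar>D\<bar>
      + pinv (diag_mat Lz) ** \<bar>L ** Minv\<bar> *v vstack \<bar>f\<bar> \<bar>g\<bar>"
    unfolding v by (simp add: matrix_vector_right_distrib matrix_vector_mul_assoc)
  \<comment> \<open>The limits are unique, so they are the values of \<open>Lim\<close>.\<close>
  show ?thesis
    unfolding Let_def Minv_def[symmetric] Lz_def[symmetric] G_def[symmetric] v[symmetric]
      Pv[symmetric] norm_data_vec[symmetric] q0_def[symmetric] cond_K_def cond_M_def cond_C_def
    using tendsto_imp_Lim_at_right[OF K] tendsto_imp_Lim_at_right[OF M]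
      tendsto_imp_Lim_at_right[OF C] by blast
qed

end
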